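(* Let $G$ be a finite simple chordal graph (every induced cycle of $G$ has length three). If $G$ is vertex decomposable, then $\mathrm{Shed}(G)$ is a dominating set of $G$.
   Context: All graphs are finite and simple. For a graph $G=(V,E)$ and $x\in V$, $G\setminus x$ is the graph obtained by deleting $x$ and its incident edges; $N(x)$ is the set of neighbours of $x$, $N[x]=N(x)\cup\{x\}$, and $G\setminus N[x]$ is obtained by deleting all vertices of $N[x]$ and their incident edges. A graph is well-covered if all its maximal independent sets have the same cardinality. A graph $G$ is vertex decomposable if $G$ is well-covered and either (i) $G$ has no edges (possibly no vertices), or (ii) there is a vertex $x$ such that both $G\setminus x$ and $G\setminus N[x]$ are vertex decomposable. For a vertex decomposable graph $G$, $\mathrm{Shed}(G)$ is the set of vertices $x$ such that $G\setminus x$ and $G\setminus N[x]$ are both vertex decomposable. A set $D\subseteq V$ is dominating if every vertex of $V\setminus D$ is adjacent to a vertex of $D$. *)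

theory Defs
  imports "HOL-Library.Ramsey"
begin

record 'a ugraph =
  verts :: "'a set"
  edges :: "'a set set"

definition finite_simple_graph :: "'a ugraph \<Rightarrow> bool" where
  "finite_simple_graph G \<longleftrightarrow> finite (verts G) \<and> edges G \<subseteq> [verts G]\<^bsup>2\<^esup>"

definition adjacent :: "'a ugraph \<Rightarrow> 'a \<Rightarrow> 'a \<Rightarrow> bool" where
  "adjacent G x y \<longleftrightarrow> {x, y} \<in> edges G"

definition nbhd :: "'a ugraph \<Rightarrow> 'a \<Rightarrow> 'a set" where
  "nbhd G x = {y \<in> verts G. adjacent G x y}"

definition closed_nbhd :: "'a ugraph \<Rightarrow> 'a \<Rightarrow> 'a set" where
  "closed_nbhd G x = insert x (nbhd G x)"

definition delete_verts :: "'a ugraph \<Rightarrow> 'a set \<Rightarrow> 'a ugraph" where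
  "delete_verts G X = \<lparr>verts = verts G - X, edges = {e \<in> edges G. e \<inter> X = {}}\<rparr>"

definition independent_set :: "'a ugraph \<Rightarrow> 'a set \<Rightarrow> bool" where
  "independent_set G S \<longleftrightarrow> S \<subseteq> verts G \<and> (\<forall>x\<in>S. \<forall>y\<in>S. \<not> adjacent G x y)"

definition maximal_independent_set :: "'a ugraph \<Rightarrow> 'a set \<Rightarrow> bool" where
  "maximal_independent_set G S \<longleftrightarrow>
     independent_set G S \<and> (\<forall>T. independent_set G T \<and> S \<subseteq> T \<longrightarrow> T = S)"

definition well_covered :: "'a ugraph \<Rightarrow> bool" where
  "well_covered G \<longleftrightarrow>
     (\<forall>S T. maximal_independent_set G S \<and> maximal_independent_set G T \<longrightarrow> card S = card T)"

text \<open>On finite graphs the recursion is on the number of vertices, so the least fixed point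
  below is the only predicate satisfying the recursive description.\<close>

inductive vertex_decomposable :: "'a ugraph \<Rightarrow> bool" where
  edgeless: "well_covered G \<Longrightarrow> edges G = {} \<Longrightarrow> vertex_decomposable G"
| shedding: "well_covered G \<Longrightarrow> x \<in> verts G \<Longrightarrow>
    vertex_decomposable (delete_verts G {x}) \<Longrightarrow>
    vertex_decomposable (delete_verts G (closed_nbhd G x)) \<Longrightarrow>
    vertex_decomposable G"

definition Shed :: "'a ugraph \<Rightarrow> 'a set" where
  "Shed G = {x \<in> verts G. vertex_decomposable (delete_verts G {x}) \<and>
                          vertex_decomposable (delete_verts G (closed_nbhd G x))}"

definition dominating_set :: "'a ugraph \<Rightarrow> 'a set \<Rightarrow> bool" where
  "dominating_set G D \<longleftrightarrow> D \<subseteq> verts G \<and> (\<forall>v \<in> verts G - D. \<exists>d\<in>D. adjacent G v d)"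

definition cycle_edges :: "'a list \<Rightarrow> 'a set set" where
  "cycle_edges c = {{c ! i, c ! (Suc i mod length c)} | i. i < length c}"

text \<open>A cycle is given by the list of its vertices in cyclic order. It is induced if the subgraph
  of \<open>G\<close> induced on its vertices has no edges besides those of the cycle.\<close>

definition induced_cycle :: "'a ugraph \<Rightarrow> 'a list \<Rightarrow> bool" where
  "induced_cycle G c \<longleftrightarrow> length c \<ge> 3 \<and> distinct c \<and> set c \<subseteq> verts G \<and>
     {e \<in> edges G. e \<subseteq> set c} = cycle_edges c"

definition chordal :: "'a ugraph \<Rightarrow> bool" where
  "chordal G \<longleftrightarrow> (\<forall>c. induced_cycle G c \<longrightarrow> length c = 3)"

end

theory Submission
  imports Defs
begin

text \<open>
  In a chordal graph every proper clique misses some simplicial vertex; hence a clique all of whose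
  vertices have neighbours outside it is dominated by an independent set disjoint from it.
  If a chordal graph is well-covered, this forces its vertices to be covered by the closed
  neighbourhoods of simplicial vertices: delete the closed neighbourhood of a simplicial vertex,
  cover the rest by induction using one clique less than the independence number, and observe that
  a clique of that cover which is no closed neighbourhood in the whole graph could be avoided
  by a maximal independent set, which would then be too small.
  On the other hand, deleting a neighbour of a simplicial vertex preserves well-coveredness, so
  well-covered chordal graphs are vertex decomposable and all neighbours of simplicial vertices,
  as well as all isolated vertices, are shedding. Every vertex is therefore shedding or adjacent
  to a shedding vertex.
\<close>

section \<open>Induced subgraphs and independent sets\<close>

lemma adjacent_commute: "adjacent G x y \<longleftrightarrow> adjacent G y x"
  by (simp add: adjacent_def insert_commute)

lemma adjacentD:
  assumes "finite_simple_graph G" "adjacent G x y"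
  shows "x \<in> verts G" "y \<in> verts G" "x \<noteq> y"
proof -
  have "{x, y} \<in> [verts G]\<^bsup>2\<^esup>"
    using assms unfolding finite_simple_graph_def adjacent_def by blast
  then show "x \<in> verts G" "y \<in> verts G" "x \<noteq> y"
    by (auto simp: nsets_def card_insert_if split: if_splits)
qed

lemma not_adjacent_self: "finite_simple_graph G \<Longrightarrow> \<not> adjacent G x x"
  using adjacentD(3)[of G x x] by blast

lemma edge_cases:
  assumes "finite_simple_graph G" "e \<in> edges G"
  obtains x y where "e = {x, y}" "x \<noteq> y" "adjacent G x y"
proof -
  have "e \<in> [verts G]\<^bsup>2\<^esup>"
    using assms by (auto simp: finite_simple_graph_def)
  then have "card e = 2" by (simp add: nsets_def)
  then obtain x y where "e = {x, y}" "x \<noteq> y" by (auto simp: card_2_iff)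
  with assms(2) show thesis by (intro that) (auto simp: adjacent_def)
qed

lemma finite_verts: "finite_simple_graph G \<Longrightarrow> finite (verts G)"
  by (simp add: finite_simple_graph_def)

lemma verts_delete_verts [simp]: "verts (delete_verts G X) = verts G - X"
  by (simp add: delete_verts_def)

lemma adjacent_delete_verts [simp]:
  "adjacent (delete_verts G X) x y \<longleftrightarrow> adjacent G x y \<and> x \<notin> X \<and> y \<notin> X"
  by (auto simp: delete_verts_def adjacent_def)

lemma finite_simple_graph_delete_verts:
  assumes "finite_simple_graph G"
  shows "finite_simple_graph (delete_verts G X)"
proof -
  have "e \<in> [verts G - X]\<^bsup>2\<^esup>" if "e \<in> edges G" "e \<inter> X = {}" for e
  proof -
    have "e \<in> [verts G]\<^bsup>2\<^esup>" using assms that by (auto simp: finite_simple_graph_def)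
    with that(2) show ?thesis by (auto simp: nsets_def)
  qed
  with assms show ?thesis
    by (auto simp: finite_simple_graph_def delete_verts_def)
qed

text \<open>Deletion keeps every edge between surviving vertices, so an induced cycle of the smaller
  graph is an induced cycle of \<open>G\<close>.\<close>

lemma chordal_delete_verts:
  assumes "chordal G"
  shows "chordal (delete_verts G X)"
  unfolding chordal_def
proof (intro allI impI)
  fix c
  assume c: "induced_cycle (delete_verts G X) c"
  have "{e \<in> edges G. e \<subseteq> set c} = {e \<in> edges (delete_verts G X). e \<subseteq> set c}"
    using c by (auto simp: induced_cycle_def delete_verts_def)
  with c have "induced_cycle G c"
    by (auto simp: induced_cycle_def)
  with assms show "length c = 3"
    by (simp add: chordal_def)
qed

lemma independent_set_insert:
  assumes "finite_simple_graph G" "independent_set G S" "v \<in> verts G"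
    and "\<And>s. s \<in> S \<Longrightarrow> \<not> adjacent G v s"
  shows "independent_set G (insert v S)"
  using assms(2-4) not_adjacent_self[OF assms(1)] adjacent_commute[of G v]
  unfolding independent_set_def by blast

text \<open>Subsets of independent sets are independent, so maximality can be tested by adding
  single vertices. This turns it into domination, the form used in the deletion arguments
  below.\<close>

lemma maximal_independent_set_iff:
  assumes "finite_simple_graph G"
  shows "maximal_independent_set G S \<longleftrightarrow>
    independent_set G S \<and> (\<forall>v \<in> verts G - S. \<exists>s\<in>S. adjacent G v s)"
proof
  assume S: "maximal_independent_set G S"
  have "\<exists>s\<in>S. adjacent G v s" if v: "v \<in> verts G - S" for v
  proof (rule ccontr)
    assume "\<not> ?thesis"
    then have "independent_set G (insert v S)"
      using S v by (intro independent_set_insert[OF assms]) (auto simp: maximal_independent_set_def)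
    with S v show False
      by (auto simp: maximal_independent_set_def)
  qed
  with S show "independent_set G S \<and> (\<forall>v \<in> verts G - S. \<exists>s\<in>S. adjacent G v s)"
    by (simp add: maximal_independent_set_def)
next
  assume "independent_set G S \<and> (\<forall>v \<in> verts G - S. \<exists>s\<in>S. adjacent G v s)"
  then show "maximal_independent_set G S"
    unfolding maximal_independent_set_def independent_set_def by blast
qed

lemma independent_set_extend:
  assumes "finite_simple_graph G" "independent_set G S"
  obtains M where "maximal_independent_set G M" "S \<subseteq> M"
proof -
  let ?F = "{T. independent_set G T \<and> S \<subseteq> T}"
  have "?F \<subseteq> Pow (verts G)"
    by (auto simp: independent_set_def)
  then have "finite ?F"
    using finite_verts[OF assms(1)] by (meson finite_Pow_iff finite_subset)
  moreover have "?F \<noteq> {}" using assms(2) by blast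
  ultimately have "\<exists>M\<in>?F. \<forall>T\<in>?F. M \<subseteq> T \<longrightarrow> M = T"
    by (rule finite_has_maximal)
  then obtain M where "M \<in> ?F" "\<forall>T\<in>?F. M \<subseteq> T \<longrightarrow> M = T" ..
  then have "maximal_independent_set G M" "S \<subseteq> M"
    by (auto simp: maximal_independent_set_def)
  then show thesis by (rule that)
qed

text \<open>The vertex \<open>x\<close> dominates exactly the deleted neighbours and is adjacent to
  none of the remaining vertices. The second conclusion is for counting: the size grows by exactly
  one.\<close>

lemma maximal_independent_set_insert_delete_closed_nbhd:
  assumes "finite_simple_graph G" "x \<in> verts G"
    and S: "maximal_independent_set (delete_verts G (closed_nbhd G x)) S"
  shows "maximal_independent_set G (insert x S)" "x \<notin> S"
proof -
  note H = finite_simple_graph_delete_verts[OF assms(1), of "closed_nbhd G x"]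
  have ind: "independent_set (delete_verts G (closed_nbhd G x)) S"
    and dom: "\<And>v. v \<in> verts G - closed_nbhd G x - S \<Longrightarrow> \<exists>s\<in>S. adjacent G v s"
    using S unfolding maximal_independent_set_iff[OF H] by auto
  show "x \<notin> S"
    using ind by (auto simp: independent_set_def closed_nbhd_def)
  have sub: "S \<subseteq> verts G - closed_nbhd G x"
    using ind by (auto simp: independent_set_def)
  have "independent_set G (insert x S)"
    using ind sub assms(2)
    by (intro independent_set_insert[OF assms(1)])
      (auto simp: independent_set_def closed_nbhd_def nbhd_def)
  moreover have "\<exists>s\<in>insert x S. adjacent G v s" if "v \<in> verts G - insert x S" for v
    using that dom[of v]
    by (cases "v \<in> closed_nbhd G x") (auto simp: closed_nbhd_def nbhd_def adjacent_commute[of G x v])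
  ultimately show "maximal_independent_set G (insert x S)"
    by (simp add: maximal_independent_set_iff[OF assms(1)])
qed

lemma well_covered_delete_closed_nbhd:
  assumes "finite_simple_graph G" "well_covered G" "x \<in> verts G"
  shows "well_covered (delete_verts G (closed_nbhd G x))"
  unfolding well_covered_def
proof (intro allI impI, elim conjE)
  fix S T
  assume S: "maximal_independent_set (delete_verts G (closed_nbhd G x)) S"
    and T: "maximal_independent_set (delete_verts G (closed_nbhd G x)) T"
  note ST = maximal_independent_set_insert_delete_closed_nbhd[OF assms(1,3) S]
    maximal_independent_set_insert_delete_closed_nbhd[OF assms(1,3) T]
  then have "S \<subseteq> verts G" "T \<subseteq> verts G"
    by (auto simp: maximal_independent_set_def independent_set_def)
  then have "finite S" "finite T"
    using finite_verts[OF assms(1)] finite_subset by blast+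
  moreover have "card (insert x S) = card (insert x T)"
    using ST assms(2) unfolding well_covered_def by blast
  ultimately show "card S = card T"
    using ST by simp
qed

section \<open>Simplicial vertices of chordal graphs\<close>

definition simplicial :: "'a ugraph \<Rightarrow> 'a \<Rightarrow> bool" where
  "simplicial G s \<longleftrightarrow> s \<in> verts G \<and> clique (nbhd G s) (edges G)"

lemma simplicial_adjacent:
  "simplicial G s \<Longrightarrow> x \<in> nbhd G s \<Longrightarrow> y \<in> nbhd G s \<Longrightarrow> x \<noteq> y \<Longrightarrow> adjacent G x y"
  by (auto simp: simplicial_def clique_def adjacent_def)

lemma simplicial_clique: "simplicial G s \<Longrightarrow> clique (closed_nbhd G s) (edges G)"
  by (auto simp: simplicial_def clique_def closed_nbhd_def nbhd_def adjacent_def insert_commute)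

text \<open>Replaces the set equation and the modular successor of \<open>induced_cycle\<close> by a
  test on ordered pairs of positions; the disjunct with \<open>i = 0\<close> is the closing
  edge.\<close>

lemma induced_cycleI:
  assumes "finite_simple_graph G" "length c \<ge> 3" "distinct c" "set c \<subseteq> verts G"
    and adj: "\<And>i j. i < j \<Longrightarrow> j < length c \<Longrightarrow>
      adjacent G (c ! i) (c ! j) \<longleftrightarrow> j = Suc i \<or> i = 0 \<and> Suc j = length c"
  shows "induced_cycle G c"
proof -
  have "e \<in> cycle_edges c" if e: "e \<in> edges G" "e \<subseteq> set c" for e
  proof -
    obtain x y where xy: "e = {x, y}" "x \<noteq> y" "adjacent G x y"
      using edge_cases[OF assms(1) e(1)] by blast
    then obtain i j where ij: "i < length c" "j < length c" "x = c ! i" "y = c ! j"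
      using e(2) by (auto simp: in_set_conv_nth)
    have main: "{c ! i, c ! j} \<in> cycle_edges c"
      if "i < j" "j < length c" "adjacent G (c ! i) (c ! j)" for i j
      using that(3) unfolding adj[OF that(1,2)]
    proof
      assume "j = Suc i"
      then show ?thesis using that by (auto simp: cycle_edges_def intro!: exI[of _ i])
    next
      assume "i = 0 \<and> Suc j = length c"
      then show ?thesis using that
        by (auto simp: cycle_edges_def insert_commute intro!: exI[of _ j])
    qed
    from xy(2) ij(3,4) have "i < j \<or> j < i"
      by (metis linorder_neqE_nat)
    then show ?thesis
    proof
      assume "i < j"
      then show ?thesis using main[of i j] ij xy by simp
    next
      assume "j < i"
      then show ?thesis using main[of j i] ij xy
        by (simp add: adjacent_commute[of G "c ! i" "c ! j"] insert_commute)
    qed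
  qed
  moreover have "e \<in> edges G \<and> e \<subseteq> set c" if e: "e \<in> cycle_edges c" for e
  proof -
    obtain i where i: "i < length c" "e = {c ! i, c ! (Suc i mod length c)}"
      using e by (auto simp: cycle_edges_def)
    show ?thesis
    proof (cases "Suc i = length c")
      case True
      then have "adjacent G (c ! 0) (c ! i)"
        using adj[of 0 i] assms(2) by simp
      then have "e \<in> edges G"
        using True i by (simp add: adjacent_def insert_commute)
      then show ?thesis using i True assms(2) by (auto intro: nth_mem)
    next
      case False
      with i have "Suc i < length c" by simp
      then show ?thesis using adj[of i "Suc i"] i by (auto simp: adjacent_def)
    qed
  qed
  ultimately have "{e \<in> edges G. e \<subseteq> set c} = cycle_edges c"
    by blast
  with assms(2-4) show ?thesis
    by (simp add: induced_cycle_def)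
qed

text \<open>In a walk of minimal length, a repeated vertex or a step of \<open>R\<close> jumping
  ahead would give a shortcut.\<close>

lemma shortest_path:
  fixes R :: "('a \<times> 'a) set"
  assumes "(x, y) \<in> R\<^sup>*"
  obtains p n where "p 0 = x" "p n = y" "inj_on p {..n}"
    "\<And>i. i < n \<Longrightarrow> (p i, p (Suc i)) \<in> R"
    "\<And>i j. i < j \<Longrightarrow> j \<le> n \<Longrightarrow> (p i, p j) \<in> R \<Longrightarrow> j = Suc i"
proof -
  define n where "n = (LEAST n. (x, y) \<in> R ^^ n)"
  have "\<exists>n. (x, y) \<in> R ^^ n"
    using assms by (rule rtrancl_imp_relpow)
  then have "(x, y) \<in> R ^^ n"
    unfolding n_def by (metis LeastI_ex)
  have min: "n \<le> m" if "(x, y) \<in> R ^^ m" for m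
    unfolding n_def using that by (rule Least_le)
  from \<open>(x, y) \<in> R ^^ n\<close> obtain p where p: "p 0 = x" "p n = y" "\<And>i. i < n \<Longrightarrow> (p i, p (Suc i)) \<in> R"
    by (auto simp: relpow_fun_conv)
  have seg: "(p i, p j) \<in> R ^^ (j - i)" if "i \<le> j" "j \<le> n" for i j
    unfolding relpow_fun_conv using that p(3)
    by (intro exI[of _ "\<lambda>k. p (i + k)"]) auto
  \<comment> \<open>Splicing a walk of \<open>m\<close> steps between positions \<open>i\<close> and
    \<open>j\<close> into the path yields one of length \<open>i + m + (n - j)\<close>, which is at
    least \<open>n\<close>. Below, \<open>m = 0\<close> gives injectivity and \<open>m = 1\<close>
    the absence of forward chords.\<close>
  have short: "j \<le> i + m" if "(p i, p j) \<in> R ^^ m" "i \<le> j" "j \<le> n" for i j m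
  proof -
    have "(x, p i) \<in> R ^^ i" "(p j, y) \<in> R ^^ (n - j)"
      using seg[of 0 i] seg[of j n] that p by auto
    with that(1) have "(x, y) \<in> R ^^ (i + m + (n - j))"
      by (auto simp: relpow_add)
    with min that(3) show ?thesis by fastforce
  qed
  have "p i \<noteq> p j" if "i < j" "j \<le> n" for i j
    using short[of i j 0] that by auto
  then have "inj_on p {..n}"
    by (intro linorder_inj_onI') auto
  moreover have "j = Suc i" if "i < j" "j \<le> n" "(p i, p j) \<in> R" for i j
    using short[of i j 1] that by auto
  ultimately show thesis
    using that p by blast
qed

text \<open>If \<open>x\<close> and \<open>y\<close> were not adjacent, a shortest path between them
  with inner vertices in \<open>K\<close> would have at least two edges. Since \<open>v\<close> has
  no neighbour in \<open>K\<close>, closing the path through \<open>v\<close> would give an induced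
  cycle of length at least four.\<close>

lemma chordal_common_nbrs_adjacent:
  assumes fsg: "finite_simple_graph G" and "chordal G"
    and x: "adjacent G v x" and y: "adjacent G v y" and "x \<noteq> y"
    and K: "K \<subseteq> verts G - closed_nbhd G v"
    and path: "(x, y) \<in> {(a, b). a \<in> K \<union> {x, y} \<and> b \<in> K \<union> {x, y} \<and> adjacent G a b}\<^sup>*"
  shows "adjacent G x y"
proof (rule ccontr)
  assume nadj: "\<not> adjacent G x y"
  let ?R = "{(a, b). a \<in> K \<union> {x, y} \<and> b \<in> K \<union> {x, y} \<and> adjacent G a b}"
  obtain p n where p: "p 0 = x" "p n = y" "inj_on p {..n}"
    "\<And>i. i < n \<Longrightarrow> (p i, p (Suc i)) \<in> ?R"
    "\<And>i j. i < j \<Longrightarrow> j \<le> n \<Longrightarrow> (p i, p j) \<in> ?R \<Longrightarrow> j = Suc i"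
    using shortest_path[OF path] by blast
  have "n \<noteq> 0" using p(1,2) \<open>x \<noteq> y\<close> by metis
  have "n \<noteq> 1" using p(1,2) p(4)[of 0] nadj by auto
  have n: "n \<ge> 2" using \<open>n \<noteq> 0\<close> \<open>n \<noteq> 1\<close> by simp
  have W: "p i \<in> K \<union> {x, y}" if "i \<le> n" for i
    using p(2) p(4)[of i] that by (cases "i = n") auto
  have inner: "p i \<in> K" if "0 < i" "i < n" for i
  proof -
    have "p i \<noteq> p 0" "p i \<noteq> p n"
      using that inj_onD[OF p(3), of i 0] inj_onD[OF p(3), of i n] by auto
    with W[of i] p that show ?thesis by auto
  qed
  have v: "v \<notin> K \<union> {x, y}" "v \<in> verts G"
    using K adjacentD[OF fsg x] adjacentD[OF fsg y] by (auto simp: closed_nbhd_def)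
  \<comment> \<open>With \<open>v\<close> in front, position \<open>Suc i\<close> of
    \<open>c\<close> is \<open>p i\<close>; the edge at positions 0 and 1 is
    \<open>v\<close>-\<open>x\<close>, and the closing edge is
    \<open>v\<close>-\<open>y\<close>.\<close>
  define c where "c = v # map p [0..<Suc n]"
  have len: "length c = n + 2" by (simp add: c_def)
  have c0: "c ! 0 = v" by (simp add: c_def)
  have cS: "c ! Suc i = p i" if "i \<le> n" for i
    using that by (simp add: c_def del: upt_Suc)
  have "induced_cycle G c"
  proof (rule induced_cycleI[OF fsg])
    show "length c \<ge> 3" using n len by simp
    have "v \<notin> p ` {..n}" using v W by force
    then show "distinct c"
      using p(3) by (auto simp: c_def distinct_map lessThan_Suc_atMost atLeast0LessThan
          simp del: upt_Suc)
    have "p ` {..n} \<subseteq> verts G"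
      using W K adjacentD[OF fsg x] adjacentD[OF fsg y] by blast
    then show "set c \<subseteq> verts G"
      using v by (auto simp: c_def simp del: upt_Suc)
    fix i j
    assume ij: "i < j" "j < length c"
    then obtain j' where j': "j = Suc j'" "j' \<le> n"
      using len by (cases j) auto
    show "adjacent G (c ! i) (c ! j) \<longleftrightarrow> j = Suc i \<or> i = 0 \<and> Suc j = length c"
    proof (cases i)
      case 0
      have "adjacent G v (p j') \<longleftrightarrow> j' = 0 \<or> j' = n"
      proof
        assume "adjacent G v (p j')"
        then have "p j' \<notin> K"
          using K by (auto simp: closed_nbhd_def nbhd_def)
        with inner[of j'] j' show "j' = 0 \<or> j' = n" by linarith
      qed (use p x y in auto)
      with 0 j' c0 cS[of j'] len show ?thesis by auto
    next
      case (Suc i')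
      have "adjacent G (p i') (p j') \<longleftrightarrow> j' = Suc i'"
      proof
        assume "adjacent G (p i') (p j')"
        with p(5)[of i' j'] W[of i'] W[of j'] show "j' = Suc i'"
          using ij Suc j' by auto
      qed (use p(4)[of i'] j' in auto)
      with Suc j' cS[of j'] cS[of i'] ij show ?thesis by auto
    qed
  qed
  with \<open>chordal G\<close> len n show False
    by (auto simp: chordal_def)
qed

text \<open>Dirac's theorem, strengthened by the clique to be avoided so that the induction goes through:
  a component of the non-neighbours of a vertex attaches to the rest of the graph along a clique.\<close>

lemma ex_simplicial_outside_clique:
  assumes "finite_simple_graph G" "chordal G"
    and "C \<subset> verts G" "clique C (edges G)"
  shows "\<exists>s. simplicial G s \<and> s \<notin> C"
  using assms
proof (induction "card (verts G)" arbitrary: G C rule: less_induct)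
  case less
  note fsg = \<open>finite_simple_graph G\<close>
  show ?case
  proof (cases "clique (verts G) (edges G)")
    case True
    obtain s where "s \<in> verts G" "s \<notin> C" using less.prems(3) by blast
    with True show ?thesis
      by (auto simp: simplicial_def clique_def nbhd_def)
  next
    case False
    \<comment> \<open>The closed neighbourhood of \<open>v\<close> has to contain \<open>C\<close>,
      so that any vertex found outside it avoids \<open>C\<close>. A vertex of \<open>C\<close> with
      a non-neighbour will do, as \<open>C\<close> is a clique; if there is none, all of
      \<open>C\<close> is adjacent to everything else, and any vertex with a non-neighbour will
      do.\<close>
    have "\<exists>v\<in>verts G. C \<subseteq> closed_nbhd G v \<and> \<not> verts G \<subseteq> closed_nbhd G v"
    proof (cases "\<exists>v\<in>C. \<not> verts G \<subseteq> closed_nbhd G v")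
      case True
      then show ?thesis
        using less.prems(3,4)
        by (fastforce simp: clique_def closed_nbhd_def nbhd_def adjacent_def)
    next
      case univ: False
      obtain v w where vw: "v \<in> verts G" "w \<in> verts G" "v \<noteq> w" "\<not> adjacent G v w"
        using False by (auto simp: clique_def adjacent_def)
      have "C \<subseteq> closed_nbhd G v"
      proof
        fix c assume "c \<in> C"
        with univ vw(1) less.prems(3) show "c \<in> closed_nbhd G v"
          using adjacent_commute[of G v c] by (auto simp: closed_nbhd_def nbhd_def)
      qed
      then show ?thesis
        using vw by (auto simp: closed_nbhd_def nbhd_def)
    qed
    then obtain v u where v: "v \<in> verts G" "C \<subseteq> closed_nbhd G v"
      and u: "u \<in> verts G" "u \<notin> closed_nbhd G v"
      by blast
    define U where "U = verts G - closed_nbhd G v"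
    define R where "R = {(a, b). a \<in> U \<and> b \<in> U \<and> adjacent G a b}"
    \<comment> \<open>\<open>K\<close> is the component of \<open>u\<close> among the non-neighbours
      of \<open>v\<close>, and \<open>S\<close> is the set of neighbours of \<open>v\<close> to
      which it attaches.\<close>
    define K where "K = {w. (u, w) \<in> R\<^sup>*}"
    define S where "S = {x \<in> nbhd G v. \<exists>k\<in>K. adjacent G x k}"
    have "u \<in> K" by (simp add: K_def)
    have KU: "K \<subseteq> U"
    proof
      fix w assume "w \<in> K"
      then have "(u, w) \<in> R\<^sup>*" by (simp add: K_def)
      then show "w \<in> U" by (induction rule: rtrancl_induct) (use u in \<open>auto simp: U_def R_def\<close>)
    qed
    have K_nbhd: "x \<in> K \<union> S" if "k \<in> K" "adjacent G k x" for k x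
    proof (cases "x \<in> U")
      case True
      then have "(k, x) \<in> R" using that KU by (auto simp: R_def)
      with that(1) show ?thesis by (auto simp: K_def)
    next
      case False
      have "k \<in> U" using that(1) KU by blast
      have "x \<noteq> v"
        using \<open>k \<in> U\<close> that(2) adjacent_commute[of G k x]
        by (auto simp: U_def closed_nbhd_def nbhd_def)
      with False that adjacentD[OF fsg that(2)] show ?thesis
        using adjacent_commute[of G k x] by (auto simp: U_def S_def closed_nbhd_def)
    qed
    \<comment> \<open>Two vertices of \<open>S\<close> each have a neighbour in the connected set
      \<open>K\<close>, so a path through \<open>K\<close> joins them, and \<open>v\<close> is a
      common neighbour without neighbours in \<open>K\<close>.\<close>
    have S: "clique S (edges G)"
      unfolding clique_def
    proof (intro ballI impI)
      fix x y
      assume xS: "x \<in> S" and yS: "y \<in> S" and "x \<noteq> y"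
      let ?R = "{(a, b). a \<in> K \<union> {x, y} \<and> b \<in> K \<union> {x, y} \<and> adjacent G a b}"
      have uK: "(u, w) \<in> ?R\<^sup>*" if "w \<in> K" for w
      proof -
        have "(u, w) \<in> R\<^sup>*" using that by (simp add: K_def)
        then show ?thesis
        proof (induction rule: rtrancl_induct)
          case (step b c)
          then have "b \<in> K" "c \<in> K"
            by (auto simp: K_def intro: rtrancl_into_rtrancl)
          with step show ?case
            by (auto simp: R_def intro: rtrancl_into_rtrancl)
        qed simp
      qed
      have "sym ?R" by (auto simp: sym_def adjacent_commute)
      then have sym: "sym (?R\<^sup>*)" by (rule sym_rtrancl)
      obtain k l where "k \<in> K" "adjacent G x k" "l \<in> K" "adjacent G y l"
        using xS yS by (auto simp: S_def)
      then have "(k, x) \<in> ?R" "(l, y) \<in> ?R"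
        by (auto simp: adjacent_commute)
      then have "(u, x) \<in> ?R\<^sup>*" "(u, y) \<in> ?R\<^sup>*"
        using uK \<open>k \<in> K\<close> \<open>l \<in> K\<close> by (meson rtrancl.rtrancl_into_rtrancl)+
      then have "(x, y) \<in> ?R\<^sup>*"
        using sym by (meson rtrancl_trans symD)
      then have "adjacent G x y"
        using xS yS KU \<open>x \<noteq> y\<close>
        by (intro chordal_common_nbrs_adjacent[OF fsg less.prems(2), of v x y K])
          (simp_all add: S_def nbhd_def U_def)
      then show "{x, y} \<in> edges G" by (simp add: adjacent_def)
    qed
    define H where "H = delete_verts G (verts G - (K \<union> S))"
    have vH: "verts H = K \<union> S"
      using KU by (auto simp: H_def U_def S_def nbhd_def)
    have vKS: "v \<notin> K \<union> S"
      using KU not_adjacent_self[OF fsg] by (auto simp: U_def S_def closed_nbhd_def nbhd_def)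
    \<comment> \<open>Induction applies with \<open>S\<close> as the clique to avoid, since
      \<open>H\<close> omits \<open>v\<close>. The vertex obtained lies in \<open>K\<close>, whose
      neighbours in \<open>G\<close> all lie in \<open>K \<union> S\<close>, so it is simplicial in
      \<open>G\<close> as well.\<close>
    have "\<exists>s. simplicial H s \<and> s \<notin> S"
    proof (rule less.hyps)
      have "verts H \<subset> verts G"
        using vH vKS v(1) KU by (auto simp: U_def S_def nbhd_def)
      then show "card (verts H) < card (verts G)"
        by (intro psubset_card_mono finite_verts[OF fsg])
      show "finite_simple_graph H" "chordal H"
        using finite_simple_graph_delete_verts[OF fsg] chordal_delete_verts[OF less.prems(2)]
        by (auto simp: H_def)
      have "u \<notin> S" using u by (auto simp: S_def closed_nbhd_def)
      with \<open>u \<in> K\<close> show "S \<subset> verts H" using vH by auto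
      show "clique S (edges H)"
        using S by (auto simp: H_def delete_verts_def clique_def)
    qed
    then obtain s where s: "simplicial H s" "s \<notin> S" by blast
    then have sK: "s \<in> K" using vH by (auto simp: simplicial_def)
    have "nbhd G s \<subseteq> nbhd H s"
    proof
      fix x assume "x \<in> nbhd G s"
      with K_nbhd[OF sK, of x] sK show "x \<in> nbhd H s"
        by (auto simp: nbhd_def H_def)
    qed
    moreover have "edges H \<subseteq> edges G"
      by (auto simp: H_def delete_verts_def)
    ultimately have "simplicial G s"
      using s(1) sK KU unfolding simplicial_def clique_def U_def by blast
    moreover have "s \<notin> C"
      using sK KU v(2) by (auto simp: U_def)
    ultimately show ?thesis by blast
  qed
qed

text \<open>The clique stays fixed while simplicial vertices \<open>s\<close> outside it are peeled
  off. If \<open>s\<close> has a neighbour in the set \<open>J\<close> found for the rest, that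
  neighbour also dominates the neighbours of \<open>s\<close> in \<open>C\<close>, because the
  neighbourhood of \<open>s\<close> is a clique; otherwise \<open>s\<close> can join
  \<open>J\<close>. Vertices with all neighbours in \<open>C\<close> are exempt: no set disjoint
  from \<open>C\<close> dominates them.\<close>

lemma ex_independent_set_dominating_clique:
  assumes "finite_simple_graph G" "chordal G"
    and "C \<subseteq> verts G" "clique C (edges G)"
  shows "\<exists>J. independent_set G J \<and> J \<inter> C = {} \<and>
    (\<forall>c\<in>C. nbhd G c \<subseteq> C \<or> (\<exists>j\<in>J. adjacent G c j))"
  using assms
proof (induction "card (verts G)" arbitrary: G rule: less_induct)
  case less
  note fsg = \<open>finite_simple_graph G\<close>
  show ?case
  proof (cases "C = verts G")
    case True
    then show ?thesis
      by (intro exI[of _ "{}"]) (auto simp: independent_set_def nbhd_def)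
  next
    case False
    with less.prems(3) have "C \<subset> verts G" by blast
    from ex_simplicial_outside_clique[OF less.prems(1,2) this less.prems(4)]
    obtain s where s: "simplicial G s" "s \<notin> C" by blast
    then have sG: "s \<in> verts G" by (simp add: simplicial_def)
    have "\<exists>J. independent_set (delete_verts G {s}) J \<and> J \<inter> C = {} \<and>
      (\<forall>c\<in>C. nbhd (delete_verts G {s}) c \<subseteq> C \<or> (\<exists>j\<in>J. adjacent (delete_verts G {s}) c j))"
    proof (rule less.hyps)
      show "card (verts (delete_verts G {s})) < card (verts G)"
        using sG finite_verts[OF fsg] by (simp add: card_Diff1_less del: card_Diff_insert)
      show "clique C (edges (delete_verts G {s}))"
        using less.prems(4) s(2) by (auto simp: clique_def delete_verts_def)
    qed (use less.prems s finite_simple_graph_delete_verts chordal_delete_verts in auto)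
    \<comment> \<open>A vertex of \<open>C\<close> whose only neighbour outside \<open>C\<close> is
      \<open>s\<close> may be left undominated by \<open>J\<close>; the two cases below repair
      this.\<close>
    then obtain J where J: "independent_set (delete_verts G {s}) J" "J \<inter> C = {}"
      "\<And>c. c \<in> C \<Longrightarrow> nbhd G c - {s} \<subseteq> C \<or> (\<exists>j\<in>J. adjacent G c j)"
      using s(2) by (fastforce simp: nbhd_def)
    have JG: "independent_set G J" "s \<notin> J"
      using J(1) by (auto simp: independent_set_def)
    show ?thesis
    proof (cases "\<exists>j\<in>J. adjacent G s j")
      case True
      then obtain j where j: "j \<in> J" "adjacent G s j" by blast
      have "nbhd G c \<subseteq> C \<or> (\<exists>j\<in>J. adjacent G c j)" if c: "c \<in> C" for c
      proof (cases "adjacent G s c")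
        case True
        moreover have "c \<noteq> j" using c j J(2) by blast
        ultimately have "adjacent G c j"
          using j adjacentD(2)[OF fsg] by (intro simplicial_adjacent[OF s(1)]) (auto simp: nbhd_def)
        with j show ?thesis by blast
      next
        case False
        then have "s \<notin> nbhd G c" by (simp add: nbhd_def adjacent_commute[of G c s])
        with J(3)[OF c] show ?thesis by blast
      qed
      with JG J(2) show ?thesis by blast
    next
      case False
      have "independent_set G (insert s J)"
        using False JG sG by (intro independent_set_insert[OF fsg]) auto
      moreover have "nbhd G c \<subseteq> C \<or> (\<exists>j\<in>insert s J. adjacent G c j)" if "c \<in> C" for c
        using J(3)[OF that] by (cases "adjacent G c s") (auto simp: nbhd_def)
      ultimately show ?thesis
        using J(2) s(2) by (intro exI[of _ "insert s J"]) auto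
    qed
  qed
qed

section \<open>Well-covered chordal graphs\<close>

text \<open>A clique contains at most one vertex of an independent set, so choosing for each vertex
  a clique around it is injective.\<close>

lemma card_independent_set_le_clique_cover:
  assumes "independent_set G I" "finite \<Q>" "I \<subseteq> \<Union>\<Q>"
    and "\<And>Q. Q \<in> \<Q> \<Longrightarrow> clique Q (edges G)"
  shows "card I \<le> card \<Q>"
proof -
  have "\<forall>i\<in>I. \<exists>Q. Q \<in> \<Q> \<and> i \<in> Q"
    using assms(3) by blast
  then obtain f where f: "\<And>i. i \<in> I \<Longrightarrow> f i \<in> \<Q> \<and> i \<in> f i"
    using bchoice[of I "\<lambda>i Q. Q \<in> \<Q> \<and> i \<in> Q"] by blast
  have "inj_on f I"
  proof (rule inj_onI, rule ccontr)
    fix i j assume "i \<in> I" "j \<in> I" "f i = f j" "i \<noteq> j"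
    then have "adjacent G i j"
      using f[of i] f[of j] assms(4)[of "f i"] by (auto simp: clique_def adjacent_def)
    with assms(1) \<open>i \<in> I\<close> \<open>j \<in> I\<close> show False by (simp add: independent_set_def)
  qed
  then show ?thesis
    using f assms(2) by (intro card_inj_on_le[of f]) auto
qed

text \<open>The cardinality clause drives the induction: it leaves no slack in the cover, so a
  maximal independent set missing one of the inherited cliques would be too small.\<close>

lemma well_covered_chordal_simplicial_cover:
  assumes "finite_simple_graph G" "chordal G" "well_covered G"
  shows "\<exists>\<Q>. finite \<Q> \<and> \<Union>\<Q> = verts G \<and>
    (\<forall>Q\<in>\<Q>. \<exists>t. simplicial G t \<and> Q = closed_nbhd G t) \<and>
    (\<forall>I. maximal_independent_set G I \<longrightarrow> card \<Q> \<le> card I)"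
  using assms
proof (induction "card (verts G)" arbitrary: G rule: less_induct)
  case less
  note fsg = \<open>finite_simple_graph G\<close>
  show ?case
  proof (cases "verts G = {}")
    case True
    then show ?thesis by (intro exI[of _ "{}"]) auto
  next
    case False
    then obtain s where s: "simplicial G s"
      using ex_simplicial_outside_clique[OF less.prems(1,2), of "{}"] by (auto simp: clique_def)
    then have sG: "s \<in> verts G" by (simp add: simplicial_def)
    define H where "H = delete_verts G (closed_nbhd G s)"
    have fsgH: "finite_simple_graph H"
      unfolding H_def by (rule finite_simple_graph_delete_verts[OF fsg])
    have vH: "verts H = verts G - closed_nbhd G s" by (simp add: H_def)
    have "\<exists>\<Q>. finite \<Q> \<and> \<Union>\<Q> = verts H \<and>
      (\<forall>Q\<in>\<Q>. \<exists>t. simplicial H t \<and> Q = closed_nbhd H t) \<and>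
      (\<forall>I. maximal_independent_set H I \<longrightarrow> card \<Q> \<le> card I)"
    proof (rule less.hyps)
      have "verts H \<subset> verts G" using sG by (auto simp: vH closed_nbhd_def)
      then show "card (verts H) < card (verts G)"
        by (intro psubset_card_mono finite_verts[OF fsg])
      show "chordal H" "well_covered H"
        unfolding H_def using chordal_delete_verts[OF less.prems(2)]
          well_covered_delete_closed_nbhd[OF fsg less.prems(3) sG] by auto
    qed (rule fsgH)
    then obtain \<Q> where \<Q>: "finite \<Q>" "\<Union>\<Q> = verts H"
      "\<forall>Q\<in>\<Q>. \<exists>t. simplicial H t \<and> Q = closed_nbhd H t"
      "\<forall>I. maximal_independent_set H I \<longrightarrow> card \<Q> \<le> card I"
      by (elim exE conjE) (rule that)
    have \<Q>_clique: "clique Q (edges G)" if Q: "Q \<in> \<Q>" for Q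
    proof -
      obtain t where "simplicial H t" "Q = closed_nbhd H t" using \<Q>(3) Q by auto
      then have "clique Q (edges H)" using simplicial_clique[of H t] by simp
      then show ?thesis unfolding clique_def H_def delete_verts_def by simp
    qed
    obtain I where I: "maximal_independent_set H I"
      using independent_set_extend[OF fsgH, of "{}"] by (auto simp: independent_set_def)
    note sI = maximal_independent_set_insert_delete_closed_nbhd[OF fsg sG I[unfolded H_def]]
    have "I \<subseteq> verts G" using sI by (auto simp: maximal_independent_set_def independent_set_def)
    then have "finite I" using finite_verts[OF fsg] finite_subset by blast
    \<comment> \<open>Adding \<open>s\<close> to \<open>I\<close> gives a maximal independent set of
      \<open>G\<close>; well-coveredness transfers its size to every \<open>M\<close>.\<close>
    have alpha: "Suc (card \<Q>) \<le> card M" if "maximal_independent_set G M" for M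
    proof -
      have "card M = card (insert s I)"
        using that sI(1) less.prems(3) unfolding well_covered_def by blast
      then show ?thesis using sI(2) \<open>finite I\<close> \<Q>(4)[rule_format, OF I] by simp
    qed
    have "\<exists>t. simplicial G t \<and> Q = closed_nbhd G t" if Q: "Q \<in> \<Q>" for Q
    proof (rule ccontr)
      assume none: "\<not> ?thesis"
      have QG: "Q \<subseteq> verts G" using Q \<Q>(2) vH by blast
      from ex_independent_set_dominating_clique[OF less.prems(1,2) QG \<Q>_clique[OF Q]]
      obtain J where J: "independent_set G J" "J \<inter> Q = {}"
        "\<And>c. c \<in> Q \<Longrightarrow> nbhd G c \<subseteq> Q \<or> (\<exists>j\<in>J. adjacent G c j)"
        by blast
      \<comment> \<open>The exempt case cannot occur: if all neighbours of \<open>c\<close> were in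
        \<open>Q\<close>, then \<open>c\<close> would be simplicial in \<open>G\<close> with closed
        neighbourhood \<open>Q\<close>.\<close>
      have J_dom: "\<exists>j\<in>J. adjacent G c j" if c: "c \<in> Q" for c
      proof (rule ccontr)
        assume "\<not> ?thesis"
        with J(3)[OF c] have sub: "nbhd G c \<subseteq> Q" by blast
        have "Q \<subseteq> closed_nbhd G c"
          using \<Q>_clique[OF Q] c QG
          by (auto simp: clique_def closed_nbhd_def nbhd_def adjacent_def)
        with sub c have "Q = closed_nbhd G c" by (auto simp: closed_nbhd_def)
        moreover have "simplicial G c"
          using sub \<Q>_clique[OF Q] c QG by (auto simp: simplicial_def clique_def)
        ultimately show False using none by blast
      qed
      obtain M where M: "maximal_independent_set G M" "J \<subseteq> M"
        using independent_set_extend[OF fsg J(1)] by blast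
      have ind: "independent_set G M" using M(1) by (simp add: maximal_independent_set_def)
      \<comment> \<open>Every vertex of \<open>Q\<close> has a neighbour in \<open>J\<close>, hence
        in \<open>M\<close>. So \<open>M\<close> is covered by the other cliques and the closed
        neighbourhood of \<open>s\<close>, at most \<open>card \<Q>\<close> cliques in all, against
        \<open>alpha\<close>.\<close>
      have "M \<inter> Q = {}"
        using J_dom M(2) ind by (fastforce simp: independent_set_def)
      moreover have "M \<subseteq> closed_nbhd G s \<union> \<Union>\<Q>"
        using ind \<Q>(2) vH by (auto simp: independent_set_def)
      ultimately have "M \<subseteq> \<Union>(insert (closed_nbhd G s) (\<Q> - {Q}))" by blast
      then have "card M \<le> card (insert (closed_nbhd G s) (\<Q> - {Q}))"
        using \<Q>(1) \<Q>_clique simplicial_clique[OF s]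
        by (intro card_independent_set_le_clique_cover[OF ind]) auto
      also have "\<dots> \<le> Suc (card (\<Q> - {Q}))"
        by (rule card_insert_le_m1) auto
      also have "\<dots> = card \<Q>"
        using Q \<Q>(1) by (rule card_Suc_Diff1[rotated])
      finally show False using alpha[OF M(1)] by simp
    qed
    moreover have "\<Union>(insert (closed_nbhd G s) \<Q>) = verts G"
      using \<Q>(2) vH sG by (auto simp: closed_nbhd_def nbhd_def)
    moreover have "card (insert (closed_nbhd G s) \<Q>) \<le> card M"
      if "maximal_independent_set G M" for M
      using alpha[OF that] card_insert_if[OF \<Q>(1), of "closed_nbhd G s"] by (auto split: if_splits)
    ultimately show ?thesis
      using s \<Q>(1) by (intro exI[of _ "insert (closed_nbhd G s) \<Q>"]) auto
  qed
qed

corollary well_covered_chordal_in_simplicial_nbhd: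
  assumes "finite_simple_graph G" "chordal G" "well_covered G" "v \<in> verts G"
  obtains s where "simplicial G s" "v \<in> closed_nbhd G s"
proof -
  obtain \<Q> where "\<Union>\<Q> = verts G" "\<forall>Q\<in>\<Q>. \<exists>t. simplicial G t \<and> Q = closed_nbhd G t"
    using well_covered_chordal_simplicial_cover[OF assms(1-3)] by (elim exE conjE) (rule that)
  with assms(4) that show thesis by blast
qed

text \<open>A maximal independent set of the smaller graph contains \<open>s\<close> or a neighbour
  of \<open>s\<close>. That vertex is adjacent to \<open>x\<close>, as both lie in the clique
  \<open>closed_nbhd G s\<close>, so the set remains maximal in \<open>G\<close>.\<close>

lemma well_covered_delete_nbr_of_simplicial:
  assumes "finite_simple_graph G" "well_covered G" "simplicial G s" "adjacent G s x"
  shows "well_covered (delete_verts G {x})"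
proof -
  note fsg = assms(1)
  have "maximal_independent_set G S" if S: "maximal_independent_set (delete_verts G {x}) S" for S
  proof -
    have ind: "independent_set G S" "x \<notin> S"
      and dom: "\<And>v. v \<in> verts G - {x} - S \<Longrightarrow> \<exists>t\<in>S. adjacent G v t"
      using S unfolding maximal_independent_set_iff[OF finite_simple_graph_delete_verts[OF fsg]]
      by (auto simp: independent_set_def)
    have "\<exists>t\<in>S. t \<in> closed_nbhd G s"
      using dom[of s] adjacentD(1,3)[OF fsg assms(4)] adjacentD(2)[OF fsg, of s]
      by (cases "s \<in> S") (auto simp: closed_nbhd_def nbhd_def)
    then obtain t where t: "t \<in> S" "t \<in> closed_nbhd G s" by blast
    then have "x \<noteq> t" using ind by blast
    with t have "adjacent G x t"
      using simplicial_clique[OF assms(3)] assms(4) adjacentD[OF fsg assms(4)]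
      by (auto simp: clique_def closed_nbhd_def nbhd_def adjacent_def)
    with dom t(1) ind(1) show ?thesis
      by (auto simp: maximal_independent_set_iff[OF fsg])
  qed
  with assms(2) show ?thesis by (auto simp: well_covered_def)
qed

section \<open>Vertex decomposability and shedding vertices\<close>

lemma well_covered_chordal_vertex_decomposable:
  assumes "finite_simple_graph G" "chordal G" "well_covered G"
  shows "vertex_decomposable G"
  using assms
proof (induction "card (verts G)" arbitrary: G rule: less_induct)
  case less
  note fsg = \<open>finite_simple_graph G\<close>
  have vd: "vertex_decomposable (delete_verts G X)"
    if "x \<in> X" "x \<in> verts G" "well_covered (delete_verts G X)" for x X
  proof (rule less.hyps)
    have "verts (delete_verts G X) \<subset> verts G" using that by auto
    then show "card (verts (delete_verts G X)) < card (verts G)"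
      by (intro psubset_card_mono finite_verts[OF fsg])
  qed (use that less.prems finite_simple_graph_delete_verts chordal_delete_verts in auto)
  show ?case
  proof (cases "edges G = {}")
    case True
    with less.prems(3) show ?thesis by (rule vertex_decomposable.edgeless)
  next
    case False
    then obtain e where "e \<in> edges G" by blast
    then obtain a b where ab: "adjacent G a b"
      using edge_cases[OF fsg] by blast
    \<comment> \<open>An endpoint \<open>a\<close> of an edge lies in the closed neighbourhood of a
      simplicial vertex \<open>t\<close>. Either \<open>a\<close> is \<open>t\<close> and
      \<open>b\<close> is the wanted neighbour, or \<open>a\<close> itself is.\<close>
    obtain s x where s: "simplicial G s" "adjacent G s x"
    proof -
      obtain t where t: "simplicial G t" "a \<in> closed_nbhd G t"
        by (rule well_covered_chordal_in_simplicial_nbhd[OF less.prems adjacentD(1)[OF fsg ab]])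
      show thesis
      proof (cases "a = t")
        case True
        with t ab show thesis by (intro that[of a b]) auto
      next
        case False
        with t show thesis by (intro that[of t a]) (auto simp: closed_nbhd_def nbhd_def)
      qed
    qed
    have x: "x \<in> verts G" by (rule adjacentD[OF fsg s(2)])
    show ?thesis
      using less.prems(3) x
    proof (rule vertex_decomposable.shedding)
      show "vertex_decomposable (delete_verts G {x})"
        using vd[of x "{x}"] x well_covered_delete_nbr_of_simplicial[OF fsg less.prems(3) s] by blast
      show "vertex_decomposable (delete_verts G (closed_nbhd G x))"
        using vd[of x "closed_nbhd G x"] x well_covered_delete_closed_nbhd[OF fsg less.prems(3) x]
        by (auto simp: closed_nbhd_def)
    qed
  qed
qed

text \<open>For well-covered chordal graphs shedding reduces to well-coveredness of one deletion,
  since deleting a closed neighbourhood always preserves it.\<close>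

lemma well_covered_chordal_ShedI:
  assumes "finite_simple_graph G" "chordal G" "well_covered G" "x \<in> verts G"
    and "well_covered (delete_verts G {x})"
  shows "x \<in> Shed G"
  unfolding Shed_def
  using assms well_covered_delete_closed_nbhd
  by (auto intro!: well_covered_chordal_vertex_decomposable
      finite_simple_graph_delete_verts chordal_delete_verts)

lemma vertex_decomposable_well_covered: "vertex_decomposable G \<Longrightarrow> well_covered G"
  by (cases rule: vertex_decomposable.cases) auto

theorem theorem2p12:
  fixes G :: "'a ugraph"
  assumes "finite_simple_graph G"
    and "chordal G"
    and "vertex_decomposable G"
  shows "dominating_set G (Shed G)"
proof -
  note fsg = assms(1)
  note wc = vertex_decomposable_well_covered[OF assms(3)]
  have nbr: "x \<in> Shed G" if "simplicial G s" "adjacent G s x" for s x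
    using well_covered_chordal_ShedI[OF fsg assms(2) wc]
      well_covered_delete_nbr_of_simplicial[OF fsg wc that] adjacentD[OF fsg that(2)] by blast
  have "\<exists>d\<in>Shed G. adjacent G v d" if v: "v \<in> verts G - Shed G" for v
  proof -
    obtain s where s: "simplicial G s" "v \<in> closed_nbhd G s"
      using well_covered_chordal_in_simplicial_nbhd[OF fsg assms(2) wc, of v] v by blast
    \<comment> \<open>Neighbours of \<open>s\<close> are shedding and \<open>v\<close> is not, which
      leaves only \<open>v = s\<close>.\<close>
    with nbr[OF s(1), of v] v have "v = s"
      by (auto simp: closed_nbhd_def nbhd_def)
    \<comment> \<open>For an isolated \<open>v\<close>, deleting \<open>v\<close> is deleting its
      closed neighbourhood, so \<open>v\<close> would be shedding. Hence \<open>v\<close> has a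
      neighbour, which is shedding because \<open>v\<close> is simplicial.\<close>
    have "nbhd G v \<noteq> {}"
    proof
      assume "nbhd G v = {}"
      then have "well_covered (delete_verts G {v})"
        using well_covered_delete_closed_nbhd[OF fsg wc, of v] v by (simp add: closed_nbhd_def)
      with v well_covered_chordal_ShedI[OF fsg assms(2) wc] show False by blast
    qed
    then show ?thesis
      using nbr s(1) \<open>v = s\<close> by (auto simp: nbhd_def)
  qed
  then show ?thesis
    by (auto simp: dominating_set_def Shed_def)
qed

end
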